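(* Let $M$ be a real Hilbert space, let $G$ be a finite group acting isometrically on $M$, and let $Y_1,\dots,Y_I\in M$ be a sample. Let $\hat m$ be the result of the max-max algorithm. Suppose that for every $i\in\{1,\dots,I\}$ the registration of $Y_i$ with respect to $\hat m$ is unique (i.e. there is a unique $g\in G$ minimizing $g\mapsto\|\hat m-g\cdot Y_i\|$ over $G$). Then $\hat m$ is a local minimum of the empirical variance $$F_I(x)=\frac1I\sum_{i=1}^I\min_{g\in G}\|x-g\cdot Y_i\|^2,\qquad x\in M,$$ i.e. $[\hat m]$ is an empirical Karcher mean.
   Context: The action of $G$ on $M$ is isometric if for each $g\in G$ the map $x\mapsto g\cdot x$ is linear and preserves the norm. The orbit of $x\in M$ is $[x]=\{g\cdot x: g\in G\}$. For $x\in M$ and $\underline g=(g_1,\dots,g_I)\in G^I$ define $J(x,\underline g)=\frac1I\sum_{i=1}^I\|x-g_i\cdot Y_i\|^2$. Max-max algorithm: starting from some $m_0\in M$, for $n=0,1,2,\dots$: (1) choose $\underline g^n=(g_1^n,\dots,g_I^n)\in G^I$ minimizing $\underline g\mapsto J(m_n,\underline g)$ (i.e. each $g_i^n$ minimizes $g\mapsto\|m_n-g\cdot Y_i\|$ over $G$: $Y_i$ is registered with respect to $m_n$); (2) let $m_{n+1}=\frac1I\sum_{i=1}^I g_i^n\cdot Y_i$, the unique minimizer of $x\mapsto J(x,\underline g^n)$. The algorithm is stopped as soon as $m_{n+1}=m_n$, and its result is $\hat m=m_n$ for this $n$. An element that minimizes $F_I$ locally is called an empirical Karcher mean. *)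

theory Defs
  imports "HOL-Analysis.Analysis" "HOL-Algebra.Group_Action"
begin

text \<open>The action is written \<open>\<phi> g x\<close> for \<open>g \<cdot> x\<close>; it is a group action in the sense of
  \<^locale>\<open>group_action\<close> on the whole Hilbert space. Samples \<open>Y\<close> are indexed by \<open>{1..I}\<close>,
  and tuples in the \<open>I\<close>-fold power of \<open>G\<close> are elements of \<open>{1..I} \<rightarrow>\<^sub>E carrier G\<close>.\<close>

locale isometric_action = group_action G UNIV \<phi>
  for G (structure) and \<phi> :: "'g \<Rightarrow> 'm::{real_inner, complete_space} \<Rightarrow> 'm" +
  assumes linear_act: "g \<in> carrier G \<Longrightarrow> linear (\<phi> g)"
    and norm_act: "g \<in> carrier G \<Longrightarrow> norm (\<phi> g x) = norm x"

definition is_local_min :: "('m::topological_space \<Rightarrow> real) \<Rightarrow> 'm \<Rightarrow> bool" where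
  "is_local_min f x \<longleftrightarrow> (\<forall>\<^sub>F y in nhds x. f x \<le> f y)"

definition J_crit ::
  "('g \<Rightarrow> 'm::real_inner \<Rightarrow> 'm) \<Rightarrow> nat \<Rightarrow> (nat \<Rightarrow> 'm) \<Rightarrow> 'm \<Rightarrow> (nat \<Rightarrow> 'g) \<Rightarrow> real" where
  "J_crit \<phi> I Y x h = (1 / real I) * (\<Sum>i = 1..I. (norm (x - \<phi> (h i) (Y i)))\<^sup>2)"

text \<open>The minimum below is meaningful when \<open>carrier G\<close> is finite (and nonempty).\<close>

definition empirical_variance ::
  "('g, 'b) monoid_scheme \<Rightarrow> ('g \<Rightarrow> 'm::real_inner \<Rightarrow> 'm) \<Rightarrow> nat \<Rightarrow> (nat \<Rightarrow> 'm) \<Rightarrow> 'm \<Rightarrow> real" where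
  "empirical_variance G \<phi> I Y x =
     (1 / real I) * (\<Sum>i = 1..I. Min ((\<lambda>g. (norm (x - \<phi> g (Y i)))\<^sup>2) ` carrier G))"

definition is_registration ::
  "('g, 'b) monoid_scheme \<Rightarrow> ('g \<Rightarrow> 'm::real_inner \<Rightarrow> 'm) \<Rightarrow> 'm \<Rightarrow> 'm \<Rightarrow> 'g \<Rightarrow> bool" where
  "is_registration G \<phi> m y = is_arg_min (\<lambda>g. norm (m - \<phi> g y)) (\<lambda>g. g \<in> carrier G)"

text \<open>A run of the max-max algorithm with iterates \<open>m 0, m 1, \<dots>\<close> and registrations
  \<open>h 0, h 1, \<dots>\<close> that stops at step \<open>N\<close>, the first index with \<open>m (Suc N) = m N\<close>.
  The starting point and the choice among several minimizers are arbitrary; the values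
  of \<open>m\<close> beyond \<open>Suc N\<close> and of \<open>h\<close> beyond \<open>N\<close> are irrelevant.\<close>

definition max_max_run ::
  "('g, 'b) monoid_scheme \<Rightarrow> ('g \<Rightarrow> 'm::real_inner \<Rightarrow> 'm) \<Rightarrow> nat \<Rightarrow> (nat \<Rightarrow> 'm) \<Rightarrow>
    (nat \<Rightarrow> 'm) \<Rightarrow> (nat \<Rightarrow> nat \<Rightarrow> 'g) \<Rightarrow> nat \<Rightarrow> bool" where
  "max_max_run G \<phi> I Y m h N \<longleftrightarrow>
     (\<forall>n\<le>N. is_arg_min (J_crit \<phi> I Y (m n)) (\<lambda>k. k \<in> {1..I} \<rightarrow>\<^sub>E carrier G) (h n) \<and>
            m (Suc n) = (1 / real I) *\<^sub>R (\<Sum>i = 1..I. \<phi> (h n i) (Y i))) \<and>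
     (\<forall>n<N. m (Suc n) \<noteq> m n) \<and> m (Suc N) = m N"

definition max_max_result ::
  "('g, 'b) monoid_scheme \<Rightarrow> ('g \<Rightarrow> 'm::real_inner \<Rightarrow> 'm) \<Rightarrow> nat \<Rightarrow> (nat \<Rightarrow> 'm) \<Rightarrow> 'm \<Rightarrow> bool" where
  "max_max_result G \<phi> I Y mhat \<longleftrightarrow> (\<exists>m h N. max_max_run G \<phi> I Y m h N \<and> mhat = m N)"

text \<open>For an isometric action the empirical variance is constant on orbits and the quotient map
  is open, so being a local minimizer does not depend on the representative of the orbit.\<close>

definition empirical_Karcher_mean ::
  "('g, 'b) monoid_scheme \<Rightarrow> ('g \<Rightarrow> 'm::real_inner \<Rightarrow> 'm) \<Rightarrow> nat \<Rightarrow> (nat \<Rightarrow> 'm) \<Rightarrow> 'm set \<Rightarrow> bool" where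
  "empirical_Karcher_mean G \<phi> I Y Q \<longleftrightarrow>
     Q \<in> orbits G UNIV \<phi> \<and> (\<forall>x\<in>Q. is_local_min (empirical_variance G \<phi> I Y) x)"

end

theory Submission
  imports Defs
begin

text \<open>When the algorithm stops, \<open>mhat\<close> is the mean of the points \<open>h i \<cdot> Y i\<close>, where the tuple \<open>h\<close>
  minimizes \<open>J mhat\<close>. The coordinates of \<open>h\<close> can be varied independently, so each \<open>h i\<close> registers
  \<open>Y i\<close> with respect to \<open>mhat\<close> (lemma \<open>J_crit_arg_min_imp_registration\<close>). As this registration is
  unique, \<open>h i\<close> beats every other group element strictly at \<open>mhat\<close>, and since there are only
  finitely many of them, by continuity it stays optimal on a neighbourhood of \<open>mhat\<close>
  (lemma \<open>unique_registration_stable\<close>). On this neighbourhood the empirical variance, which is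
  the minimum of \<open>J\<close> over all tuples, is therefore the single smooth function \<open>\<lambda>x. J x h\<close>,
  and the global minimizer of that function is the mean of the \<open>h i \<cdot> Y i\<close>, that is \<open>mhat\<close>
  (lemma \<open>J_crit_mean_le\<close>). The statement passes from \<open>mhat\<close> to its whole orbit because the
  empirical variance is invariant under the action, which is by homeomorphisms.\<close>

section \<open>Invariance under the action\<close>

context isometric_action
begin

lemma continuous_act:
  assumes "g \<in> carrier G"
  shows "isCont (\<phi> g) x"
proof (rule linear_continuous_at)
  show "bounded_linear (\<phi> g)"
    using linear_act[OF assms] norm_act[OF assms]
    by (auto simp: bounded_linear_def bounded_linear_axioms_def intro: exI[of _ 1])
qed

lemma norm_act_diff:
  assumes "g \<in> carrier G" "k \<in> carrier G"
  shows "norm (\<phi> g x - \<phi> (g \<otimes> k) y) = norm (x - \<phi> k y)"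
proof -
  have "\<phi> g x - \<phi> (g \<otimes> k) y = \<phi> g (x - \<phi> k y)"
    using composition_rule[of y g k] assms linear_diff[OF linear_act[OF assms(1)]] by simp
  then show ?thesis
    using norm_act[OF assms(1)] by simp
qed

text \<open>Left translation by \<open>g\<close> permutes the group, so moving \<open>x\<close> by \<open>g\<close> merely permutes the
  distances over which each minimum is taken.\<close>

lemma empirical_variance_act:
  assumes "g \<in> carrier G"
  shows "empirical_variance G \<phi> I Y (\<phi> g x) = empirical_variance G \<phi> I Y x"
proof -
  interpret group G
    using group_hom group_hom.axioms(1) by blast
  have "(\<lambda>k. (norm (\<phi> g x - \<phi> k y))\<^sup>2) ` carrier G = (\<lambda>k. (norm (x - \<phi> k y))\<^sup>2) ` carrier G" for y
  proof -
    have "(\<lambda>k. (norm (\<phi> g x - \<phi> k y))\<^sup>2) ` carrier G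
        = (\<lambda>k. (norm (\<phi> g x - \<phi> k y))\<^sup>2) ` (\<lambda>k. g \<otimes> k) ` carrier G"
      using surj_const_mult[OF assms] by simp
    also have "\<dots> = (\<lambda>k. (norm (x - \<phi> k y))\<^sup>2) ` carrier G"
      unfolding image_image using norm_act_diff[OF assms] by (intro image_cong) simp_all
    finally show ?thesis .
  qed
  then show ?thesis
    by (simp add: empirical_variance_def)
qed

lemma is_local_min_act:
  assumes g: "g \<in> carrier G" and x: "is_local_min (empirical_variance G \<phi> I Y) x"
  shows "is_local_min (empirical_variance G \<phi> I Y) (\<phi> g x)"
proof -
  interpret group G
    using group_hom group_hom.axioms(1) by blast
  let ?F = "empirical_variance G \<phi> I Y"
  have g': "inv g \<in> carrier G"
    using g by simp
  have "filterlim (\<phi> (inv g)) (nhds x) (nhds (\<phi> g x))"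
    using continuous_act[OF g', of "\<phi> g x"] orbit_sym_aux[OF g, of x "\<phi> g x"]
    unfolding isCont_def tendsto_at_iff_tendsto_nhds by simp
  then have "\<forall>\<^sub>F y in nhds (\<phi> g x). ?F x \<le> ?F (\<phi> (inv g) y)"
    using x unfolding is_local_min_def filterlim_iff by blast
  then show ?thesis
    using empirical_variance_act[OF g] empirical_variance_act[OF g']
    by (simp add: is_local_min_def)
qed

end

section \<open>Minimizing \<open>J\<close> in each argument\<close>

text \<open>Replacing the single coordinate \<open>i\<close> of a minimizing tuple changes only the \<open>i\<close>-th summand
  of \<open>J\<close>, which therefore cannot decrease.\<close>

lemma J_crit_arg_min_imp_registration:
  assumes h: "is_arg_min (J_crit \<phi> I Y x) (\<lambda>k. k \<in> {1..I} \<rightarrow>\<^sub>E carrier G) h" and i: "i \<in> {1..I}"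
  shows "is_registration G \<phi> x (Y i) (h i)"
proof -
  have hG: "h \<in> {1..I} \<rightarrow>\<^sub>E carrier G"
    using h by (simp add: is_arg_min_def)
  have "norm (x - \<phi> (h i) (Y i)) \<le> norm (x - \<phi> g (Y i))" if g: "g \<in> carrier G" for g
  proof -
    let ?d = "\<lambda>k j. (norm (x - \<phi> (k j) (Y j)))\<^sup>2"
    let ?k = "h(i := g)"
    have "?k \<in> {1..I} \<rightarrow>\<^sub>E carrier G"
      using hG g i by (auto simp: PiE_iff extensional_def)
    then have "J_crit \<phi> I Y x h \<le> J_crit \<phi> I Y x ?k"
      using h unfolding is_arg_min_linorder by blast
    then have "sum (?d h) {1..I} \<le> sum (?d ?k) {1..I}"
      using i by (simp add: J_crit_def divide_le_cancel del: fun_upd_apply)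
    moreover have "sum (?d k) {1..I} = ?d k i + sum (?d k) ({1..I} - {i})" for k
      using i by (intro sum.remove) auto
    moreover have "sum (?d ?k) ({1..I} - {i}) = sum (?d h) ({1..I} - {i})"
      by (intro sum.cong) auto
    ultimately have "?d h i \<le> ?d ?k i"
      by simp
    then show ?thesis
      by simp
  qed
  then show ?thesis
    using hG i by (auto simp: is_registration_def is_arg_min_linorder PiE_iff)
qed

text \<open>Expanding the squares around the mean \<open>c\<close>, the cross terms cancel because the deviations from
  \<open>c\<close> sum to zero; what is left over is \<open>(norm (y - c))\<^sup>2\<close>.\<close>

lemma J_crit_mean_le:
  assumes I: "I \<ge> 1" and c: "c = (1 / real I) *\<^sub>R (\<Sum>i = 1..I. \<phi> (h i) (Y i))"
  shows "J_crit \<phi> I Y c h \<le> J_crit \<phi> I Y y h"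
proof -
  let ?a = "\<lambda>i. \<phi> (h i) (Y i)"
  have "(\<Sum>i = 1..I. c - ?a i) = real I *\<^sub>R c - (\<Sum>i = 1..I. ?a i)"
    by (simp add: sum_subtractf scaleR_conv_of_real sum_constant_scaleR)
  also have "\<dots> = 0"
    using I c by simp
  finally have cross: "(\<Sum>i = 1..I. (y - c) \<bullet> (c - ?a i)) = 0"
    by (metis inner_sum_right inner_zero_right)
  have "(norm (y - ?a i))\<^sup>2 = (norm (c - ?a i))\<^sup>2 + 2 * ((y - c) \<bullet> (c - ?a i)) + (norm (y - c))\<^sup>2" for i
    by (simp add: power2_norm_eq_inner inner_diff inner_commute algebra_simps)
  then have "(\<Sum>i = 1..I. (norm (y - ?a i))\<^sup>2)
      = (\<Sum>i = 1..I. (norm (c - ?a i))\<^sup>2) + 2 * (\<Sum>i = 1..I. (y - c) \<bullet> (c - ?a i))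
        + real I * (norm (y - c))\<^sup>2"
    by (simp add: sum.distrib sum_distrib_left)
  then have "(\<Sum>i = 1..I. (norm (c - ?a i))\<^sup>2) \<le> (\<Sum>i = 1..I. (norm (y - ?a i))\<^sup>2)"
    using cross by simp
  then show ?thesis
    by (simp add: J_crit_def divide_right_mono)
qed

section \<open>Stability of unique registrations\<close>

text \<open>Uniqueness turns the optimality of \<open>g\<close> into finitely many strict inequalities between
  continuous functions of the point, and these persist nearby.\<close>

lemma unique_registration_stable:
  assumes fin: "finite (carrier G)"
    and uniq: "\<exists>!k. is_registration G \<phi> x y k" and g: "is_registration G \<phi> x y g"
  shows "\<forall>\<^sub>F z in nhds x. is_registration G \<phi> z y g"
proof -
  have gG: "g \<in> carrier G"
    using g by (simp add: is_registration_def is_arg_min_def)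
  have "\<forall>\<^sub>F z in nhds x. norm (z - \<phi> g y) \<le> norm (z - \<phi> k y)" if k: "k \<in> carrier G" for k
  proof (cases "k = g")
    case False
    then have "\<not> is_registration G \<phi> x y k"
      using uniq g by blast
    then have "norm (x - \<phi> g y) < norm (x - \<phi> k y)"
      using g k by (force simp: is_registration_def is_arg_min_linorder)
    moreover have "open {z. norm (z - \<phi> g y) < norm (z - \<phi> k y)}"
      by (intro open_Collect_less continuous_intros)
    ultimately have "\<forall>\<^sub>F z in nhds x. norm (z - \<phi> g y) < norm (z - \<phi> k y)"
      unfolding eventually_nhds by blast
    then show ?thesis
      by (rule eventually_mono) simp
  qed simp
  then have "\<forall>\<^sub>F z in nhds x. \<forall>k\<in>carrier G. norm (z - \<phi> g y) \<le> norm (z - \<phi> k y)"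
    using fin by (intro eventually_ball_finite) auto
  then show ?thesis
    by (rule eventually_mono) (use gG in \<open>auto simp: is_registration_def is_arg_min_linorder\<close>)
qed

lemma empirical_variance_eq_J_crit:
  assumes fin: "finite (carrier G)"
    and reg: "\<And>i. i \<in> {1..I} \<Longrightarrow> is_registration G \<phi> x (Y i) (h i)"
  shows "empirical_variance G \<phi> I Y x = J_crit \<phi> I Y x h"
proof -
  have "Min ((\<lambda>g. (norm (x - \<phi> g (Y i)))\<^sup>2) ` carrier G) = (norm (x - \<phi> (h i) (Y i)))\<^sup>2"
    if "i \<in> {1..I}" for i
    using fin reg[OF that]
    by (intro Min_eqI) (auto simp: is_registration_def is_arg_min_linorder power_mono)
  then show ?thesis
    by (simp add: empirical_variance_def J_crit_def)
qed

section \<open>The result of the algorithm\<close>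

theorem proposition2p8:
  fixes G :: "('g, 'b) monoid_scheme"
    and \<phi> :: "'g \<Rightarrow> 'm::{real_inner, complete_space} \<Rightarrow> 'm"
    and I :: nat and Y :: "nat \<Rightarrow> 'm" and mhat :: 'm
  assumes "isometric_action G \<phi>"
    and "finite (carrier G)"
    and "I \<ge> 1"
    and "max_max_result G \<phi> I Y mhat"
    and "\<forall>i\<in>{1..I}. \<exists>!g. is_registration G \<phi> mhat (Y i) g"
  shows "is_local_min (empirical_variance G \<phi> I Y) mhat \<and>
         empirical_Karcher_mean G \<phi> I Y (orbit G \<phi> mhat)"
proof -
  interpret isometric_action G \<phi>
    by (rule assms(1))
  let ?F = "empirical_variance G \<phi> I Y"
  obtain m k N where "max_max_run G \<phi> I Y m k N" "mhat = m N"
    using assms(4) unfolding max_max_result_def by blast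
  then obtain h where h: "is_arg_min (J_crit \<phi> I Y mhat) (\<lambda>k. k \<in> {1..I} \<rightarrow>\<^sub>E carrier G) h"
    and mean: "mhat = (1 / real I) *\<^sub>R (\<Sum>i = 1..I. \<phi> (h i) (Y i))"
    unfolding max_max_run_def by fastforce
  have reg: "is_registration G \<phi> mhat (Y i) (h i)" if "i \<in> {1..I}" for i
    using J_crit_arg_min_imp_registration[OF h that] .
  have "\<forall>\<^sub>F z in nhds mhat. \<forall>i\<in>{1..I}. is_registration G \<phi> z (Y i) (h i)"
  proof (intro eventually_ball_finite ballI)
    fix i assume "i \<in> {1..I}"
    then show "\<forall>\<^sub>F z in nhds mhat. is_registration G \<phi> z (Y i) (h i)"
      using unique_registration_stable[OF assms(2)] assms(5) reg by blast
  qed simp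
  then have "\<forall>\<^sub>F z in nhds mhat. ?F mhat \<le> ?F z"
  proof (rule eventually_mono)
    fix z assume "\<forall>i\<in>{1..I}. is_registration G \<phi> z (Y i) (h i)"
    then have "?F z = J_crit \<phi> I Y z h"
      using empirical_variance_eq_J_crit[OF assms(2)] by blast
    moreover have "?F mhat = J_crit \<phi> I Y mhat h"
      using empirical_variance_eq_J_crit[OF assms(2)] reg by blast
    ultimately show "?F mhat \<le> ?F z"
      using J_crit_mean_le[where h = h and \<phi> = \<phi> and Y = Y, OF assms(3) mean] by simp
  qed
  then have local_min: "is_local_min ?F mhat"
    by (simp add: is_local_min_def)
  moreover have "orbit G \<phi> mhat \<in> orbits G UNIV \<phi>"
    by (auto simp: orbits_def)
  moreover have "\<forall>x\<in>orbit G \<phi> mhat. is_local_min ?F x"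
    using is_local_min_act[OF _ local_min] by (auto simp: orbit_def)
  ultimately show ?thesis
    by (simp add: empirical_Karcher_mean_def)
qed

end
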